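(* For every $0 < \varepsilon \le 1/2$ there exist positive constants $\beta$, $\delta$, $\lambda$, $C$ such that the following holds for all $\ell$ and $n$ with $\ell \ge C\sqrt{n}$. Suppose that $\mathcal{P} = (M,E)$ is a pregraph on $n$ vertices with $e(E)\le\binom{\ell}{2}$ and either (M1* ) $e(M) \ge 3\ell n$, or (M2* ) $e(M) \ge (1-\delta)\ell n$, $E$ is not $\varepsilon$-close to $K_\ell$, and $\ell \le \lambda n$. Then for any collection $\mathcal{C}$ of at most $12\beta\ell^3$ pairs of elements of $M$, there exist at least $3\beta\ell^4$ good copies of $C_4$ in $\mathcal{P}$ that contain no pair from $\mathcal{C}$.
   Context: A pregraph on $n$ vertices is a pair $\mathcal{P}=(M,E)$ of disjoint subsets of $E(K_n)$ (edges $E$, mixed edges $M$); $e(X)=|X|$. A good copy of $C_4$ in $\mathcal{P}$ is a $4$-cycle with all four edges in $M$ whose vertex set spans no element of $E$; it contains a pair $\{f_1,f_2\}\in\mathcal{C}$ if both $f_1$ and $f_2$ are among its four edges. A graph is $\varepsilon$-close to $K_\ell$ if it can be turned into a complete graph on some $\ell$ vertices (plus isolated vertices) by adding or deleting at most $\varepsilon\binom{\ell}{2}$ edges. *)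

theory Defs
  imports Complex_Main
begin

(* A graph is represented by its set of edges; edges are two-element sets of vertices. *)

definition complete_edges :: "'a set \<Rightarrow> 'a set set" where
  "complete_edges W = {e. e \<subseteq> W \<and> card e = 2}"

(* The vertex set of K_n is {..<n}. *)

definition pregraph :: "nat \<Rightarrow> nat set set \<Rightarrow> nat set set \<Rightarrow> bool" where
  "pregraph n M E \<longleftrightarrow>
     M \<subseteq> complete_edges {..<n} \<and> E \<subseteq> complete_edges {..<n} \<and> M \<inter> E = {}"

definition C4_copies :: "'a set \<Rightarrow> 'a set set set" where
  "C4_copies V = {{{a, b}, {b, c}, {c, d}, {d, a}} | a b c d.
     {a, b, c, d} \<subseteq> V \<and> distinct [a, b, c, d]}"

(* For a 4-cycle K, given by its edge set, the vertex set is the union of its edges.  Copies are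
   counted as subgraphs, so relabellings of the same 4-cycle are not distinguished. *)

definition good_C4_copies :: "nat \<Rightarrow> nat set set \<Rightarrow> nat set set \<Rightarrow> nat set set set" where
  "good_C4_copies n M E =
     {K \<in> C4_copies {..<n}. K \<subseteq> M \<and> (\<forall>e\<in>E. \<not> e \<subseteq> \<Union>K)}"

(* In close_to_complete, the edges of G outside complete_edges W are the ones to be deleted, and
   the edges of complete_edges W outside G are the ones to be added. *)

definition close_to_complete :: "nat \<Rightarrow> real \<Rightarrow> nat \<Rightarrow> nat set set \<Rightarrow> bool" where
  "close_to_complete n \<epsilon> l G \<longleftrightarrow>
     (\<exists>W \<subseteq> {..<n}. card W = l \<and>
        real (card (complete_edges W - G) + card (G - complete_edges W)) \<le> \<epsilon> * real (l choose 2))"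

end

theory Submission
  imports Defs "HOL-Analysis.Convex"
begin

text \<open>
  Give every path \<open>a, b, c\<close> of \<open>M\<close> with \<open>{a, c} \<notin> E\<close> the weight \<open>1 / d(b)\<close>, where \<open>d(b)\<close> is the
  degree of the middle vertex in \<open>M\<close>. By Cauchy--Schwarz over the \<open>n\<^sup>2\<close> pairs \<open>(a, c)\<close>, if the total
  weight is \<open>S\<close> then the 4-cycles \<open>a, b, c, d\<close> with \<open>{a, c} \<notin> E\<close>, weighted by \<open>1 / (d(b) d(d))\<close>, have
  total weight at least \<open>S\<^sup>2 / n\<^sup>2\<close>, degenerate ones included. For a fixed pair \<open>(b, d)\<close> this weight is at
  most 1, so those with \<open>b = d\<close> contribute at most \<open>n\<close>, which is small compared with \<open>l\<^sup>2\<close>, and those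
  with \<open>{b, d} \<in> E\<close> at most \<open>2 e(E) \<le> l\<^sup>2\<close>. Hence it suffices that \<open>S \<ge> (1 + c) l n\<close> for some constant
  \<open>c > 0\<close>. Now \<open>S\<close> is about \<open>2 e(M)\<close> minus the sum over \<open>b\<close> of \<open>2 e(E[N(b)]) / d(b)\<close>, and each of
  these terms is at most \<open>min (d(b)) (l\<^sup>2 / d(b)) \<le> l\<close>. This settles the case \<open>e(M) \<ge> 3 l n\<close>. If
  \<open>e(M) \<ge> (1 - \<delta>) l n\<close>, a constant factor has to be gained in the last bound; it could only fail if
  \<open>d(b)\<close> were close to \<open>l\<close> and \<open>E\<close> almost complete on \<open>N(b)\<close>, that is, if \<open>E\<close> were close to \<open>K\<^sub>l\<close>.
\<close>

section \<open>Ordered pairs, edges and binomial coefficients\<close>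

lemma card_ordered_pairs:
  assumes "finite F" and "\<And>e. e \<in> F \<Longrightarrow> card e = 2"
  shows "finite {(a, b). {a, b} \<in> F}" and "card {(a, b). {a, b} \<in> F} = 2 * card F"
proof -
  have fibre: "finite {(a, b). {a, b} = e} \<and> card {(a, b). {a, b} = e} = 2" if e: "e \<in> F" for e
  proof -
    obtain x y where "e = {x, y}" "x \<noteq> y"
      using assms(2)[OF e] by (auto simp: card_2_iff)
    then have "{(a, b). {a, b} = e} = {(x, y), (y, x)}"
      by (auto simp: doubleton_eq_iff)
    then show ?thesis using \<open>x \<noteq> y\<close> by simp
  qed
  have eq: "{(a, b). {a, b} \<in> F} = (\<Union>e\<in>F. {(a, b). {a, b} = e})" by auto
  show "finite {(a, b). {a, b} \<in> F}"
    unfolding eq using assms(1) fibre by blast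
  have "card (\<Union>e\<in>F. {(a, b). {a, b} = e}) = (\<Sum>e\<in>F. card {(a, b). {a, b} = e})"
    using assms(1) fibre by (intro card_UN_disjoint) auto
  also have "\<dots> = 2 * card F" using fibre by simp
  finally show "card {(a, b). {a, b} \<in> F} = 2 * card F" unfolding eq .
qed

lemma finite_complete_edges: "finite W \<Longrightarrow> finite (complete_edges W)"
  unfolding complete_edges_def by (rule finite_subset[of _ "Pow W"]) auto

lemma card_complete_edges: "finite W \<Longrightarrow> card (complete_edges W) = card W choose 2"
  unfolding complete_edges_def by (rule n_subsets)

lemma twice_choose_two: "2 * real (k choose 2) = real k * (real k - 1)"
proof (cases k)
  case (Suc m)
  have "even (k * (k - 1))" using Suc by (auto simp: even_mult_iff)
  then have "2 * (k choose 2) = k * (k - 1)" by (simp add: choose_two)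
  then have "2 * real (k choose 2) = real (k * (k - 1))" by linarith
  then show ?thesis using Suc by (simp add: algebra_simps)
qed simp

lemma twice_choose_two_le: "2 * real (k choose 2) \<le> (real k)\<^sup>2"
  unfolding twice_choose_two by (simp add: power2_eq_square algebra_simps)

section \<open>Edges of \<open>E\<close> inside a given vertex set\<close>

lemma card_edges_outside_subset_le:
  assumes "finite N" and "W \<subseteq> N" and "E \<subseteq> complete_edges N"
  shows "card (E - complete_edges W) \<le> (card N - card W) * card N"
proof -
  have "E - complete_edges W \<subseteq> (\<lambda>(x, y). {x, y}) ` ((N - W) \<times> N)"
  proof
    fix e assume e: "e \<in> E - complete_edges W"
    then have "e \<subseteq> N" "card e = 2" using assms(3) by (auto simp: complete_edges_def)
    then obtain x y where xy: "e = {x, y}" "x \<in> N" "y \<in> N" "card e = 2"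
      by (metis card_2_iff insert_subset)
    have "x \<notin> W \<or> y \<notin> W" using e xy by (auto simp: complete_edges_def)
    then have "(x, y) \<in> (N - W) \<times> N \<or> (y, x) \<in> (N - W) \<times> N" using xy by blast
    then show "e \<in> (\<lambda>(x, y). {x, y}) ` ((N - W) \<times> N)"
      using xy(1) by (auto simp: image_iff doubleton_eq_iff)
  qed
  then have "card (E - complete_edges W) \<le> card ((N - W) \<times> N)"
    using assms(1) by (intro surj_card_le) auto
  also have "\<dots> = (card N - card W) * card N"
    using assms by (simp add: card_cartesian_product card_Diff_subset finite_subset)
  finally show ?thesis .
qed

text \<open>The symmetric difference of \<open>E\<close> and \<open>complete_edges W\<close> has
  \<open>(l choose 2) + card E\<close> elements minus twice the size of the intersection.
  Non-closeness bounds it below, and \<open>card E\<close> is at most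
  \<open>l choose 2\<close>.\<close>

lemma card_edges_within_if_not_close:
  assumes "\<not> close_to_complete n \<epsilon> l E" and "finite E" and "card E \<le> l choose 2"
    and "W \<subseteq> {..<n}" and "card W = l"
  shows "2 * real (card (E \<inter> complete_edges W)) \<le> (2 - \<epsilon>) * real (l choose 2)"
proof -
  have fin: "finite (complete_edges W)"
    using assms(4) by (simp add: finite_complete_edges finite_subset)
  have "\<epsilon> * real (l choose 2)
      < real (card (complete_edges W - E) + card (E - complete_edges W))"
    using assms(1,4,5) unfolding close_to_complete_def by (metis not_le)
  moreover have "card (complete_edges W - E) + card (E \<inter> complete_edges W) = l choose 2"
    using card_complete_edges[of W] assms(4,5) fin
    by (metis Int_commute add.commute card_Int_Diff finite_lessThan finite_subset)
  moreover have "card (E - complete_edges W) + card (E \<inter> complete_edges W) = card E"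
    using assms(2) by (metis add.commute card_Int_Diff)
  ultimately show ?thesis using assms(3) by (simp add: algebra_simps)
qed

lemma card_edges_within_le:
  assumes "finite E" and "card E \<le> l choose 2" and "finite N"
  shows "2 * real (card (E \<inter> complete_edges N)) \<le> (real l)\<^sup>2"
    and "2 * real (card (E \<inter> complete_edges N)) \<le> (real (card N))\<^sup>2"
proof -
  have "card (E \<inter> complete_edges N) \<le> card E" using assms(1) by (simp add: card_mono)
  then show "2 * real (card (E \<inter> complete_edges N)) \<le> (real l)\<^sup>2"
    using assms(2) twice_choose_two_le[of l] by linarith
  have "card (E \<inter> complete_edges N) \<le> card N choose 2"
    using assms(3) by (metis Int_lower2 card_complete_edges card_mono finite_complete_edges)
  then show "2 * real (card (E \<inter> complete_edges N)) \<le> (real (card N))\<^sup>2"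
    using twice_choose_two_le[of "card N"] by linarith
qed

text \<open>The smaller of two squares is at most the product of their roots.\<close>

lemma card_edges_within_le_mult:
  assumes "finite E" and "card E \<le> l choose 2" and "finite N"
  shows "2 * real (card (E \<inter> complete_edges N)) \<le> real l * real (card N)"
proof (cases "card N \<le> l")
  case True
  then have "(real (card N))\<^sup>2 \<le> real l * real (card N)"
    by (simp add: power2_eq_square mult_right_mono)
  then show ?thesis using card_edges_within_le(2)[OF assms] by linarith
next
  case False
  then have "(real l)\<^sup>2 \<le> real l * real (card N)"
    by (simp add: power2_eq_square mult_left_mono)
  then show ?thesis using card_edges_within_le(1)[OF assms] by linarith
qed

text \<open>The gain of a factor \<open>1 - c\<close> over the previous bound. If
  \<open>card N\<close> is away from \<open>l\<close>, one of the two trivial bounds already gives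
  it. If \<open>card N\<close> is close to \<open>l\<close>, then \<open>N\<close> is compared with
  a set \<open>W\<close> of exactly \<open>l\<close> vertices, nested with \<open>N\<close>, to
  which non-closeness applies.\<close>

lemma card_edges_within_le_mult_if_not_close:
  assumes "\<not> close_to_complete n \<epsilon> l E" and "finite E" and "card E \<le> l choose 2"
    and "N \<subseteq> {..<n}" and "l \<le> n" and "0 < c" and "20 * c \<le> \<epsilon>" and "\<epsilon> \<le> 1/2"
  shows "2 * real (card (E \<inter> complete_edges N)) \<le> (1 - c) * real l * real (card N)"
proof -
  define d where "d = card N"
  define e where "e = card (E \<inter> complete_edges N)"
  have c: "c \<le> 1/40" using assms(7,8) by simp
  have finN: "finite N" using assms(4) finite_subset by blast
  note triv = card_edges_within_le[OF assms(2,3) finN, folded d_def e_def]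
  consider "real d \<le> (1 - c) * real l" | "real d \<ge> (1 + 2 * c) * real l"
    | "real d > (1 - c) * real l" "real d < (1 + 2 * c) * real l" by linarith
  then have "2 * real e \<le> (1 - c) * real l * real d"
  proof cases
    case 1
    then have "real d * real d \<le> (1 - c) * real l * real d" by (simp add: mult_right_mono)
    then show ?thesis using triv(2) by (simp add: power2_eq_square)
  next
    case 2
    \<comment> \<open>The threshold \<open>1 + 2 * c\<close> is chosen for this inequality: the
      product is \<open>1 + c - 2 * c * c\<close>.\<close>
    have "1 \<le> (1 - c) * (1 + 2 * c)"
    proof -
      have "2 * c * c \<le> c" using c assms(6) by (simp add: mult_le_cancel_right2)
      then show ?thesis by (simp add: algebra_simps)
    qed
    then have "(real l)\<^sup>2 \<le> ((1 - c) * (1 + 2 * c)) * (real l)\<^sup>2"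
      by (simp add: mult_le_cancel_right1)
    also have "\<dots> = (1 - c) * real l * ((1 + 2 * c) * real l)" by (simp add: power2_eq_square)
    also have "\<dots> \<le> (1 - c) * real l * real d"
      using 2 c by (intro mult_left_mono) auto
    finally show ?thesis using triv(1) by linarith
  next
    case 3
    \<comment> \<open>Passing from \<open>N\<close> to a larger \<open>W\<close> loses no edges;
      passing to a smaller \<open>W\<close> loses at most \<open>(d - l) * d\<close> of them, where
      \<open>d - l\<close> is at most \<open>2 * c * l\<close> and \<open>d\<close> at most
      \<open>2 * l\<close>.\<close>
    have outside: "real e \<le> real (card (E \<inter> complete_edges W)) + 4 * c * (real l)\<^sup>2"
      if W: "W \<subseteq> {..<n}" "W \<subseteq> N \<or> N \<subseteq> W" "card W = l" for W
    proof (cases "N \<subseteq> W")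
      case True
      then have "E \<inter> complete_edges N \<subseteq> E \<inter> complete_edges W"
        by (auto simp: complete_edges_def)
      then have "e \<le> card (E \<inter> complete_edges W)"
        unfolding e_def using assms(2) by (simp add: card_mono)
      moreover have "0 \<le> 4 * c * (real l)\<^sup>2" using assms(6) by simp
      ultimately show ?thesis by linarith
    next
      case False
      then have WN: "W \<subseteq> N" using W by blast
      have "l \<le> d" using card_mono[OF finN WN] W(3) d_def by simp
      have "E \<inter> complete_edges N \<subseteq>
          (E \<inter> complete_edges W) \<union> (E \<inter> complete_edges N - complete_edges W)" by blast
      then have "e \<le> card ((E \<inter> complete_edges W) \<union> (E \<inter> complete_edges N - complete_edges W))"
        unfolding e_def using assms(2) by (intro card_mono) auto
      also have "\<dots> \<le> card (E \<inter> complete_edges W)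
          + card (E \<inter> complete_edges N - complete_edges W)"
        by (rule card_Un_le)
      also have "\<dots> \<le> card (E \<inter> complete_edges W) + (d - l) * d"
        using card_edges_outside_subset_le[OF finN WN, of "E \<inter> complete_edges N"] W(3)
        by (simp add: d_def)
      finally have "real e \<le> real (card (E \<inter> complete_edges W)) + real ((d - l) * d)"
        by linarith
      moreover have "real ((d - l) * d) \<le> 4 * c * (real l)\<^sup>2"
      proof -
        have "real ((d - l) * d) = (real d - real l) * real d"
          using \<open>l \<le> d\<close> by (simp add: of_nat_diff)
        also have "\<dots> \<le> (2 * c * real l) * (2 * real l)"
        proof (rule mult_mono)
          show "real d - real l \<le> 2 * c * real l" using 3(2) by (simp add: algebra_simps)
          have "(1 + 2 * c) * real l \<le> 2 * real l" using c by (intro mult_right_mono) auto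
          then show "real d \<le> 2 * real l" using 3(2) by linarith
        qed (use assms(6) in auto)
        finally show ?thesis by (simp add: power2_eq_square)
      qed
      ultimately show ?thesis by linarith
    qed
    obtain W where W: "W \<subseteq> {..<n}" "W \<subseteq> N \<or> N \<subseteq> W" "card W = l"
    proof (cases "l \<le> d")
      case True
      then obtain W where "W \<subseteq> N" "card W = l"
        using obtain_subset_with_card_n[of l N] unfolding d_def by metis
      then show ?thesis using that[of W] assms(4) by auto
    next
      case False
      then obtain W where "N \<subseteq> W" "W \<subseteq> {..<n}" "card W = l"
        using exists_subset_between[of N l "{..<n}"] assms(4,5) unfolding d_def
        by (metis card_lessThan finite_lessThan nat_le_linear)
      then show ?thesis using that[of W] by auto
    qed
    have "2 * real (card (E \<inter> complete_edges W)) \<le> (2 - \<epsilon>) * real (l choose 2)"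
      using card_edges_within_if_not_close[OF assms(1,2,3) W(1,3)] .
    also have "2 * \<dots> = (2 - \<epsilon>) * (2 * real (l choose 2))" by simp
    also have "\<dots> \<le> (2 - \<epsilon>) * (real l)\<^sup>2"
      using assms(8) twice_choose_two_le[of l] by (intro mult_left_mono) auto
    finally have "4 * real (card (E \<inter> complete_edges W)) \<le> (2 - \<epsilon>) * (real l)\<^sup>2" by simp
    then have "4 * real e \<le> (2 - \<epsilon> + 16 * c) * (real l)\<^sup>2"
      using outside[OF W] by (simp add: algebra_simps)
    \<comment> \<open>The error \<open>16 * c\<close> from replacing \<open>N\<close> by
      \<open>W\<close> and the \<open>4 * c\<close> in \<open>2 * (1 - c)\<^sup>2\<close> are
      together paid for by \<epsilon>; hence the assumption
      \<open>20 * c \<le> \<epsilon>\<close>.\<close>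
    also have "\<dots> \<le> (2 * ((1 - c) * (1 - c))) * (real l)\<^sup>2"
    proof (rule mult_right_mono)
      have "2 * ((1 - c) * (1 - c)) = 2 - 4 * c + 2 * c\<^sup>2"
        by (simp add: power2_eq_square algebra_simps)
      then show "2 - \<epsilon> + 16 * c \<le> 2 * ((1 - c) * (1 - c))"
        using assms(7) zero_le_power2[of c] by linarith
    qed simp
    also have "\<dots> = 2 * ((1 - c) * real l * ((1 - c) * real l))" by (simp add: power2_eq_square)
    also have "\<dots> \<le> 2 * ((1 - c) * real l * real d)"
      using 3(1) c by (intro mult_left_mono) auto
    finally show ?thesis by linarith
  qed
  then show ?thesis unfolding d_def e_def .
qed

section \<open>Paths with a given middle vertex, and Cauchy--Schwarz\<close>

definition nbhd :: "'a set set \<Rightarrow> 'a \<Rightarrow> 'a set" where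
  "nbhd M b = {a. {a, b} \<in> M}"

text \<open>For \<open>N = nbhd M b\<close> these are the ordered end pairs of the paths through
  \<open>b\<close> that can be half of a good cycle: the ends form a diagonal of the cycle, which
  must avoid \<open>E\<close>.\<close>

definition nonadjacent_pairs :: "'a set set \<Rightarrow> 'a set \<Rightarrow> ('a \<times> 'a) set" where
  "nonadjacent_pairs E N = {(a, c). a \<in> N \<and> c \<in> N \<and> a \<noteq> c \<and> {a, c} \<notin> E}"

lemma sum_card_nbhd:
  assumes "finite V" and "M \<subseteq> complete_edges V"
  shows "(\<Sum>b\<in>V. card (nbhd M b)) = 2 * card M"
proof -
  have fin: "finite M" using assms finite_complete_edges finite_subset by blast
  have "nbhd M b \<subseteq> V" for b using assms(2) by (auto simp: nbhd_def complete_edges_def)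
  then have "(\<Sum>b\<in>V. card (nbhd M b)) = card (Sigma V (nbhd M))"
    using assms(1) by (subst card_SigmaI) (auto intro: finite_subset)
  also have "Sigma V (nbhd M) = {(a, b). {a, b} \<in> M}"
    using assms(2) by (auto simp: nbhd_def complete_edges_def insert_commute)
  also have "card \<dots> = 2 * card M"
    using assms(2) fin by (intro card_ordered_pairs(2)) (auto simp: complete_edges_def)
  finally show ?thesis .
qed

text \<open>Every other pair of \<open>N \<times> N\<close> is on the diagonal or is one of the two
  orderings of an edge of \<open>E\<close> inside \<open>N\<close>.\<close>

lemma card_nonadjacent_pairs_ge:
  assumes "finite N" and "\<And>e. e \<in> E \<Longrightarrow> card e = 2"
  shows "real (card N) * (real (card N) - 1) - 2 * real (card (E \<inter> complete_edges N))
      \<le> real (card (nonadjacent_pairs E N))"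
proof -
  define F where "F = E \<inter> complete_edges N"
  have F: "finite F" "\<And>e. e \<in> F \<Longrightarrow> card e = 2"
    using assms by (auto simp: F_def finite_complete_edges)
  have finQ: "finite (nonadjacent_pairs E N)"
    by (rule finite_subset[of _ "N \<times> N"]) (use assms(1) in \<open>auto simp: nonadjacent_pairs_def\<close>)
  have "N \<times> N \<subseteq> nonadjacent_pairs E N \<union> ((\<lambda>a. (a, a)) ` N \<union> {(a, c). {a, c} \<in> F})"
    using assms(2) by (auto simp: nonadjacent_pairs_def F_def complete_edges_def)
  then have "card (N \<times> N)
      \<le> card (nonadjacent_pairs E N \<union> ((\<lambda>a. (a, a)) ` N \<union> {(a, c). {a, c} \<in> F}))"
    using assms(1) finQ card_ordered_pairs(1)[OF F] by (intro card_mono) auto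
  also have "\<dots> \<le> card (nonadjacent_pairs E N)
      + (card ((\<lambda>a. (a, a)) ` N) + card {(a, c). {a, c} \<in> F})"
    by (meson add_left_mono card_Un_le le_trans)
  also have "\<dots> \<le> card (nonadjacent_pairs E N) + (card N + 2 * card F)"
    using card_image_le[OF assms(1), of "\<lambda>a. (a, a)"] card_ordered_pairs(2)[OF F] by simp
  finally have "card N * card N \<le> card (nonadjacent_pairs E N) + (card N + 2 * card F)"
    by (simp add: card_cartesian_product)
  then have "real (card N * card N) \<le> real (card (nonadjacent_pairs E N) + (card N + 2 * card F))"
    by (simp only: of_nat_le_iff)
  then show ?thesis by (simp add: F_def algebra_simps)
qed

text \<open>Cauchy--Schwarz for the function \<open>t\<close> that gives \<open>q\<close> the total
  weight of all \<open>b\<close> with \<open>q \<in> Q b\<close>: exchanging sums evaluates both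
  \<open>t\<close> and its square summed over \<open>P\<close>.\<close>

lemma weighted_sum_card_squared_le:
  fixes r :: "'b \<Rightarrow> real"
  assumes "finite B" and "finite P" and "\<And>b. b \<in> B \<Longrightarrow> Q b \<subseteq> P"
  shows "(\<Sum>b\<in>B. r b * real (card (Q b)))\<^sup>2
      \<le> (\<Sum>b\<in>B. \<Sum>d\<in>B. r b * r d * real (card (Q b \<inter> Q d))) * real (card P)"
proof -
  define t where "t q = (\<Sum>b\<in>B. if q \<in> Q b then r b else 0)" for q
  have count: "(\<Sum>q\<in>P. if q \<in> X then x else 0) = x * real (card X)" if "X \<subseteq> P" for X and x :: real
    using that assms(2) by (simp add: sum.If_cases Int_absorb1)
  have "(\<Sum>q\<in>P. t q) = (\<Sum>b\<in>B. \<Sum>q\<in>P. if q \<in> Q b then r b else 0)"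
    unfolding t_def by (rule sum.swap)
  also have "\<dots> = (\<Sum>b\<in>B. r b * real (card (Q b)))"
    using assms(3) by (intro sum.cong refl count) auto
  finally have S: "(\<Sum>q\<in>P. t q) = (\<Sum>b\<in>B. r b * real (card (Q b)))" .
  have "(t q)\<^sup>2 = (\<Sum>b\<in>B. \<Sum>d\<in>B. if q \<in> Q b \<inter> Q d then r b * r d else 0)" for q
    unfolding t_def power2_eq_square sum_product by (intro sum.cong refl) auto
  then have "(\<Sum>q\<in>P. (t q)\<^sup>2)
      = (\<Sum>q\<in>P. \<Sum>b\<in>B. \<Sum>d\<in>B. if q \<in> Q b \<inter> Q d then r b * r d else 0)" by simp
  also have "\<dots> = (\<Sum>b\<in>B. \<Sum>q\<in>P. \<Sum>d\<in>B. if q \<in> Q b \<inter> Q d then r b * r d else 0)"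
    by (rule sum.swap)
  also have "\<dots> = (\<Sum>b\<in>B. \<Sum>d\<in>B. \<Sum>q\<in>P. if q \<in> Q b \<inter> Q d then r b * r d else 0)"
    by (intro sum.cong refl sum.swap)
  also have "\<dots> = (\<Sum>b\<in>B. \<Sum>d\<in>B. r b * r d * real (card (Q b \<inter> Q d)))"
    using assms(3) by (intro sum.cong refl count) auto
  finally show ?thesis
    using sum_squared_le_sum_of_squares[of t P] S by simp
qed

section \<open>From path weight to the number of good cycles\<close>

lemma card_Union_two_edges_le:
  assumes "card p = 2" and "\<And>e. e \<in> p \<Longrightarrow> card e = 2"
  shows "finite (\<Union>p)" and "card (\<Union>p) \<le> 4"
proof -
  obtain e f where p: "p = {e, f}" "e \<in> p" "f \<in> p" using assms(1) by (auto simp: card_2_iff)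
  have "card e = 2" "card f = 2" using p assms(2) by auto
  moreover from this have "finite e" "finite f" by (auto intro: card_ge_0_finite)
  ultimately show "finite (\<Union>p)" "card (\<Union>p) \<le> 4"
    using p(1) card_Un_le[of e f] by auto
qed

lemma card_UN_le_mult:
  assumes "finite I" and "\<And>i. i \<in> I \<Longrightarrow> card (A i) \<le> k"
  shows "card (\<Union>i\<in>I. A i) \<le> k * card I"
  using card_UN_le[OF assms(1), of A] sum_bounded_above[of I "\<lambda>i. card (A i)" k] assms(2)
  by (simp add: mult.commute)

lemma weight_mult_le_one:
  fixes x y :: real and k :: nat
  assumes "real k \<le> x * y" and "0 < x" and "0 < y"
  shows "(1 / x) * (1 / y) * real k \<le> 1"
  using assms by (simp add: field_simps)

lemma two_elements_of_four:
  assumes "e \<noteq> f" and "{e, f} \<subseteq> {w, x, y, z}"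
  shows "{e, f} \<in> {{w, x}, {w, y}, {w, z}, {x, y}, {x, z}, {y, z}}"
proof -
  have "e \<in> {w, x, y, z}" "f \<in> {w, x, y, z}" using assms(2) by auto
  then show ?thesis using assms(1) by (elim insertE) (simp_all add: doubleton_eq_iff)
qed

text \<open>Middle vertices are restricted to degree at least \<open>\<kappa> * l\<close>, so that
  no weight exceeds \<open>1 / (\<kappa> * l)\<close>; a surplus of weight of order
  \<open>l\<^sup>2\<close> then forces order \<open>l ^ 4\<close> cycles.\<close>

lemma good_C4_count:
  fixes c \<kappa> :: real
  assumes P: "pregraph n M E" and l: "0 < l" "l \<le> n" and c: "0 < c" "c \<le> 1" and \<kappa>: "0 < \<kappa>"
    and B: "B \<subseteq> {..<n}" "\<And>b. b \<in> B \<Longrightarrow> \<kappa> * real l \<le> real (card (nbhd M b))"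
    and E: "2 * real (card E) \<le> (real l)\<^sup>2"
    and n: "real n \<le> c / 8 * (real l)\<^sup>2"
    and \<C>: "\<And>p. p \<in> \<C> \<Longrightarrow> p \<subseteq> M \<and> card p = 2" "1024 * real (card \<C>) \<le> c * \<kappa> * real l ^ 3"
    and S: "(1 + c / 2) * real l * real n
      \<le> (\<Sum>b\<in>B. real (card (nonadjacent_pairs E (nbhd M b))) / real (card (nbhd M b)))"
  shows "c * \<kappa>\<^sup>2 / 1024 * real l ^ 4
      \<le> real (card {K \<in> good_C4_copies n M E. \<forall>p\<in>\<C>. \<not> p \<subseteq> K})"
proof -
  let ?N = "nbhd M"
  define G where "G = {K \<in> good_C4_copies n M E. \<forall>p\<in>\<C>. \<not> p \<subseteq> K}"
  define r where "r b = 1 / real (card (?N b))" for b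
  define D where "D b = {(a, c) \<in> nonadjacent_pairs E (?N b). {{a, b}, {b, c}} \<in> \<C>}" for b
  define Q where "Q b = nonadjacent_pairs E (?N b) - D b" for b
  \<comment> \<open>Two edges of the cycle \<open>a, b, c, d\<close> that are neither the two at
    \<open>b\<close> nor the two at \<open>d\<close> cover \<open>b\<close>, \<open>d\<close> and at
    least one of \<open>a\<close>, \<open>c\<close>. So \<open>D\<close> and \<open>X\<close>
    together catch all six ways in which a pair of \<open>\<C>\<close> can lie in the cycle.\<close>
  define X where "X b d = {(a, c) \<in> Q b \<inter> Q d.
      \<exists>p\<in>\<C>. b \<in> \<Union>p \<and> d \<in> \<Union>p \<and> (a \<in> \<Union>p \<or> c \<in> \<Union>p)}" for b d
  define R where "R b d = (if b = d \<or> {b, d} \<in> E then {} else Q b \<inter> Q d - X b d)" for b d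
  define k where "k b d = card {p \<in> \<C>. b \<in> \<Union>p \<and> d \<in> \<Union>p}" for b d

  have Msub: "M \<subseteq> complete_edges {..<n}" and Esub: "E \<subseteq> complete_edges {..<n}"
    and disj: "M \<inter> E = {}" using P by (auto simp: pregraph_def)
  have finM: "finite M" and finE: "finite E"
    using Msub Esub finite_complete_edges finite_subset by blast+
  have cM: "card e = 2" if "e \<in> M" for e using that Msub by (auto simp: complete_edges_def)
  have cE: "card e = 2" if "e \<in> E" for e using that Esub by (auto simp: complete_edges_def)
  have Nsub: "?N b \<subseteq> {..<n}" for b using Msub by (auto simp: nbhd_def complete_edges_def)
  then have finN: "finite (?N b)" for b using finite_subset by blast
  have finB: "finite B" using B(1) finite_subset by blast
  have "\<C> \<subseteq> Pow M" using \<C>(1) by blast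
  then have fin\<C>: "finite \<C>" using finM by (meson finite_Pow_iff finite_subset)
  have Up: "finite (\<Union>p)" "card (\<Union>p) \<le> 4" if "p \<in> \<C>" for p
    using card_Union_two_edges_le[of p] \<C>(1)[OF that] cM by blast+
  have kl: "0 < \<kappa> * real l" using \<kappa> l(1) by simp
  have dpos: "0 < real (card (?N b))" if "b \<in> B" for b using B(2)[OF that] kl by linarith
  have r0: "0 \<le> r b" for b by (simp add: r_def)
  have rle: "r b \<le> 1 / (\<kappa> * real l)" if "b \<in> B" for b
    unfolding r_def using B(2)[OF that] kl by (intro divide_left_mono) auto
  have QN: "Q b \<subseteq> ?N b \<times> ?N b" "D b \<subseteq> ?N b \<times> ?N b" for b
    by (auto simp: Q_def D_def nonadjacent_pairs_def)
  have finQ: "finite (Q b)" "finite (D b)" for b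
    using QN finN finite_subset by (metis finite_SigmaI)+

  \<comment> \<open>Both losses due to \<open>\<C>\<close> are multiples of this quantity: once for
    \<open>D\<close>, twice for \<open>X\<close>.\<close>
  have l4: "64 * real (card \<C>) / (\<kappa> * real l) \<le> c / 16 * (real l)\<^sup>2"
  proof -
    have "64 * real (card \<C>) \<le> c / 16 * (real l)\<^sup>2 * (\<kappa> * real l)"
      using \<C>(2) by (simp add: power2_eq_square power3_eq_cube algebra_simps)
    then show ?thesis using kl by (simp add: pos_divide_le_eq)
  qed

  \<comment> \<open>All three vertices of a discarded path lie in \<open>\<Union>p\<close> for its
    pair \<open>p\<close>, so each \<open>p\<close> accounts for at most \<open>4 * 4 * 4\<close>
    paths.\<close>
  have "Sigma B D \<subseteq> (\<Union>p\<in>\<C>. \<Union>p \<times> \<Union>p \<times> \<Union>p)"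
  proof
    fix q assume "q \<in> Sigma B D"
    then obtain a b c where q: "q = (b, a, c)" "{{a, b}, {b, c}} \<in> \<C>" by (auto simp: D_def)
    have "q \<in> \<Union>{{a, b}, {b, c}} \<times> \<Union>{{a, b}, {b, c}} \<times> \<Union>{{a, b}, {b, c}}"
      unfolding q(1) by simp
    then show "q \<in> (\<Union>p\<in>\<C>. \<Union>p \<times> \<Union>p \<times> \<Union>p)" using q(2) by (rule UN_I[rotated])
  qed
  moreover have "(\<Sum>b\<in>B. card (D b)) = card (Sigma B D)" using finB finQ by simp
  ultimately have "(\<Sum>b\<in>B. card (D b)) \<le> card (\<Union>p\<in>\<C>. \<Union>p \<times> \<Union>p \<times> \<Union>p)"
    using fin\<C> Up by (simp add: card_mono)
  also have "\<dots> \<le> 64 * card \<C>"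
  proof (rule card_UN_le_mult[OF fin\<C>])
    fix p assume "p \<in> \<C>"
    then have "card (\<Union>p) * (card (\<Union>p) * card (\<Union>p)) \<le> 4 * (4 * 4)"
      using Up by (intro mult_le_mono) auto
    then show "card (\<Union>p \<times> \<Union>p \<times> \<Union>p) \<le> 64" by (simp add: card_cartesian_product)
  qed
  finally have "real (\<Sum>b\<in>B. card (D b)) \<le> real (64 * card \<C>)" by (rule of_nat_mono)
  then have sumD: "(\<Sum>b\<in>B. real (card (D b))) \<le> 64 * real (card \<C>)" by simp
  have "(\<Sum>b\<in>B. r b * real (card (D b))) \<le> (\<Sum>b\<in>B. 1 / (\<kappa> * real l) * real (card (D b)))"
    using rle by (intro sum_mono mult_right_mono) auto
  also have "\<dots> = 1 / (\<kappa> * real l) * (\<Sum>b\<in>B. real (card (D b)))"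
    by (simp add: sum_distrib_left)
  also have "\<dots> \<le> 1 / (\<kappa> * real l) * (64 * real (card \<C>))"
    using sumD kl by (intro mult_left_mono) auto
  also have "\<dots> \<le> c / 16 * (real l)\<^sup>2" using l4 by simp
  also have "\<dots> \<le> c / 4 * (real l * real n)"
    unfolding power2_eq_square using c l by (intro mult_mono) auto
  finally have wD: "(\<Sum>b\<in>B. r b * real (card (D b))) \<le> c / 4 * (real l * real n)" .

  \<comment> \<open>A pair of \<open>\<C>\<close> meeting at the middle vertex \<open>b\<close> may lie in as many as \<open>n\<close> cycles, so these pairs
    are discarded before Cauchy--Schwarz, where they only cost a linear term; every other pair
    of \<open>\<C>\<close> carries weight at most a constant times \<open>1 / (\<kappa> l)\<close>.\<close>
  have "(\<Sum>b\<in>B. real (card (nonadjacent_pairs E (?N b))) / real (card (?N b)))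
      = (\<Sum>b\<in>B. r b * real (card (Q b)) + r b * real (card (D b)))"
  proof (rule sum.cong[OF refl])
    fix b
    have "nonadjacent_pairs E (?N b) = Q b \<union> D b" "Q b \<inter> D b = {}"
      by (auto simp: Q_def D_def)
    then have "card (nonadjacent_pairs E (?N b)) = card (Q b) + card (D b)"
      using finQ by (simp add: card_Un_disjoint)
    then show "real (card (nonadjacent_pairs E (?N b))) / real (card (?N b))
        = r b * real (card (Q b)) + r b * real (card (D b))"
      by (simp add: r_def add_divide_distrib)
  qed
  then have S': "(1 + c / 4) * real l * real n \<le> (\<Sum>b\<in>B. r b * real (card (Q b)))"
    using S wD by (simp add: sum.distrib algebra_simps)

  define W where "W = (\<Sum>b\<in>B. \<Sum>d\<in>B. r b * r d * real (card (Q b \<inter> Q d)))"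
  have "((1 + c / 4) * real l * real n)\<^sup>2 \<le> (\<Sum>b\<in>B. r b * real (card (Q b)))\<^sup>2"
    using S' c by (intro power_mono) auto
  also have "\<dots> \<le> W * real (card ({..<n} \<times> {..<n}))"
    unfolding W_def using finB QN Nsub by (intro weighted_sum_card_squared_le) blast+
  finally have "((1 + c / 4) * real l)\<^sup>2 * (real n)\<^sup>2 \<le> W * (real n)\<^sup>2"
    by (simp add: card_cartesian_product power2_eq_square mult_ac)
  then have "((1 + c / 4) * real l)\<^sup>2 \<le> W" using l by simp
  moreover have "(1 + c / 2) * (real l)\<^sup>2 \<le> ((1 + c / 4) * real l)\<^sup>2"
    unfolding power_mult_distrib
    by (intro mult_right_mono) (auto simp: power2_eq_square algebra_simps)
  ultimately have W: "(1 + c / 2) * (real l)\<^sup>2 \<le> W" by linarith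

  \<comment> \<open>For a fixed \<open>p\<close> covering \<open>b\<close> and \<open>d\<close>, one
    of \<open>a\<close>, \<open>c\<close> is among at most 4 vertices and the other is in
    \<open>nbhd M b\<close>. The weight \<open>r b\<close> cancels the degree of \<open>b\<close>,
    and \<open>r d\<close> is at most \<open>1 / (\<kappa> * l)\<close>.\<close>
  have wX: "r b * r d * real (card (X b d)) \<le> 8 / (\<kappa> * real l) * real (k b d)"
    if bd: "b \<in> B" "d \<in> B" for b d
  proof -
    let ?I = "{p \<in> \<C>. b \<in> \<Union>p \<and> d \<in> \<Union>p}"
    have "X b d \<subseteq> (\<Union>p\<in>?I. (\<Union>p \<times> ?N b) \<union> (?N b \<times> \<Union>p))"
      using QN unfolding X_def by blast
    then have "card (X b d) \<le> card (\<Union>p\<in>?I. (\<Union>p \<times> ?N b) \<union> (?N b \<times> \<Union>p))"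
      using fin\<C> Up(1) finN by (intro card_mono) auto
    also have "\<dots> \<le> 8 * card (?N b) * card ?I"
    proof (rule card_UN_le_mult)
      fix p assume "p \<in> ?I"
      then have "card (\<Union>p) * card (?N b) \<le> 4 * card (?N b)" using Up by (intro mult_le_mono) auto
      then show "card ((\<Union>p \<times> ?N b) \<union> (?N b \<times> \<Union>p)) \<le> 8 * card (?N b)"
        using card_Un_le[of "\<Union>p \<times> ?N b" "?N b \<times> \<Union>p"]
        unfolding card_cartesian_product mult.commute[of "card (?N b)" "card (\<Union>p)"] by linarith
    qed (use fin\<C> in simp)
    finally have "real (card (X b d)) \<le> real (8 * card (?N b) * k b d)"
      unfolding k_def by (rule of_nat_mono)
    then have "real (card (X b d)) \<le> 8 * real (card (?N b)) * real (k b d)" by simp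
    then have "r b * real (card (X b d)) \<le> r b * (8 * real (card (?N b)) * real (k b d))"
      using r0 by (intro mult_left_mono) auto
    also have "\<dots> = 8 * real (k b d)" using dpos[OF bd(1)] by (simp add: r_def)
    finally have bound: "r b * real (card (X b d)) \<le> 8 * real (k b d)" .
    have "r d * (r b * real (card (X b d))) \<le> 1 / (\<kappa> * real l) * (8 * real (k b d))"
      using kl r0 by (intro mult_mono[OF rle[OF bd(2)] bound]) auto
    then show ?thesis by (simp add: mult_ac)
  qed

  \<comment> \<open>Double counting: each \<open>p\<close> covers at most 4 vertices, hence at most
    16 ordered pairs \<open>(b, d)\<close>.\<close>
  have "(\<Sum>b\<in>B. \<Sum>d\<in>B. k b d) = (\<Sum>q\<in>B \<times> B. k (fst q) (snd q))"
    by (simp add: sum.cartesian_product case_prod_beta)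
  also have "\<dots> = (\<Sum>q\<in>B \<times> B. \<Sum>p\<in>\<C>. if fst q \<in> \<Union>p \<and> snd q \<in> \<Union>p then 1 else 0)"
    using fin\<C> by (simp add: k_def sum.If_cases Int_def)
  also have "\<dots> = (\<Sum>p\<in>\<C>. \<Sum>q\<in>B \<times> B. if fst q \<in> \<Union>p \<and> snd q \<in> \<Union>p then 1 else 0)"
    by (rule sum.swap)
  also have "\<dots> \<le> (\<Sum>p\<in>\<C>. 16)"
  proof (rule sum_mono)
    fix p assume p: "p \<in> \<C>"
    have "(\<Sum>q\<in>B \<times> B. if fst q \<in> \<Union>p \<and> snd q \<in> \<Union>p then 1 else 0)
        = card {q \<in> B \<times> B. fst q \<in> \<Union>p \<and> snd q \<in> \<Union>p}"
      using finB by (simp add: sum.If_cases Int_def)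
    also have "\<dots> \<le> card (\<Union>p \<times> \<Union>p)" using Up(1)[OF p] by (intro card_mono) auto
    also have "\<dots> \<le> 4 * 4"
      unfolding card_cartesian_product using Up(2)[OF p] by (intro mult_le_mono) auto
    finally show "(\<Sum>q\<in>B \<times> B. if fst q \<in> \<Union>p \<and> snd q \<in> \<Union>p then 1 else 0) \<le> (16::nat)" by simp
  qed
  finally have "(\<Sum>b\<in>B. \<Sum>d\<in>B. k b d) \<le> 16 * card \<C>" by simp
  then have "real (\<Sum>b\<in>B. \<Sum>d\<in>B. k b d) \<le> real (16 * card \<C>)" by (rule of_nat_mono)
  then have sumk: "(\<Sum>b\<in>B. \<Sum>d\<in>B. real (k b d)) \<le> 16 * real (card \<C>)" by simp
  have "(\<Sum>b\<in>B. \<Sum>d\<in>B. r b * r d * real (card (X b d)))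
      \<le> (\<Sum>b\<in>B. \<Sum>d\<in>B. 8 / (\<kappa> * real l) * real (k b d))"
    using wX by (intro sum_mono) auto
  also have "\<dots> = 8 / (\<kappa> * real l) * (\<Sum>b\<in>B. \<Sum>d\<in>B. real (k b d))"
    by (simp add: sum_distrib_left)
  also have "\<dots> \<le> 8 / (\<kappa> * real l) * (16 * real (card \<C>))"
    using sumk kl by (intro mult_left_mono) auto
  also have "\<dots> \<le> c / 8 * (real l)\<^sup>2" using l4 by simp
  finally have wXsum: "(\<Sum>b\<in>B. \<Sum>d\<in>B. r b * r d * real (card (X b d))) \<le> c / 8 * (real l)\<^sup>2" .

  \<comment> \<open>When \<open>b = d\<close> or \<open>{b, d} \<in> E\<close>, the whole weight is
    at most 1 because \<open>Q b \<inter> Q d\<close> lies in the product of the two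
    neighbourhoods.\<close>
  have split: "r b * r d * real (card (Q b \<inter> Q d))
      \<le> (if b = d then 1 else 0) + (if {b, d} \<in> E then 1 else 0)
        + r b * r d * real (card (X b d)) + r b * r d * real (card (R b d))"
    if bd: "b \<in> B" "d \<in> B" for b d
  proof (cases "b = d \<or> {b, d} \<in> E")
    case True
    have "Q b \<inter> Q d \<subseteq> ?N b \<times> ?N d" using QN by blast
    then have "card (Q b \<inter> Q d) \<le> card (?N b) * card (?N d)"
      using finN by (metis card_cartesian_product card_mono finite_SigmaI)
    then have "real (card (Q b \<inter> Q d)) \<le> real (card (?N b)) * real (card (?N d))"
      by (metis of_nat_le_iff of_nat_mult)
    then have "r b * r d * real (card (Q b \<inter> Q d)) \<le> 1"
      unfolding r_def by (rule weight_mult_le_one) (use bd dpos in auto)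
    moreover have "0 \<le> r b * r d * real (card (X b d))" "0 \<le> r b * r d * real (card (R b d))"
      using r0 by auto
    moreover have "1 \<le> (if b = d then 1 else 0) + (if {b, d} \<in> E then 1 else (0::real))"
      using True by auto
    ultimately show ?thesis by linarith
  next
    case False
    have "Q b \<inter> Q d = X b d \<union> R b d" using False by (auto simp: R_def X_def)
    then have "real (card (Q b \<inter> Q d)) \<le> real (card (X b d)) + real (card (R b d))"
      by (metis card_Un_le of_nat_add of_nat_le_iff)
    then have "r b * r d * real (card (Q b \<inter> Q d))
        \<le> r b * r d * (real (card (X b d)) + real (card (R b d)))"
      using r0 by (intro mult_left_mono) auto
    then show ?thesis using False by (simp add: algebra_simps)
  qed

  have "(\<Sum>b\<in>B. \<Sum>d\<in>B. if b = d then 1 else (0::real)) = real (card B)"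
    using finB by simp
  also have "\<dots> \<le> real n" using B(1) by (metis card_lessThan card_mono finite_lessThan of_nat_le_iff)
  finally have diag: "(\<Sum>b\<in>B. \<Sum>d\<in>B. if b = d then 1 else (0::real)) \<le> c / 8 * (real l)\<^sup>2"
    using n by linarith
  have "(\<Sum>b\<in>B. \<Sum>d\<in>B. if {b, d} \<in> E then 1 else (0::real))
      = real (card {q \<in> B \<times> B. {fst q, snd q} \<in> E})"
    unfolding sum.cartesian_product case_prod_beta
    using finB by (simp add: sum.If_cases Int_def)
  also have "\<dots> \<le> real (card {(b, d). {b, d} \<in> E})"
    using card_ordered_pairs(1)[OF finE cE] by (intro of_nat_mono card_mono) auto
  also have "\<dots> \<le> (real l)\<^sup>2" using card_ordered_pairs(2)[OF finE cE] E by simp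
  finally have adj: "(\<Sum>b\<in>B. \<Sum>d\<in>B. if {b, d} \<in> E then 1 else (0::real)) \<le> (real l)\<^sup>2" .

  \<comment> \<open>In units of \<open>l\<^sup>2\<close>: of the \<open>1 + c / 2\<close> in
    \<open>W\<close>, at most \<open>c / 8\<close> goes to \<open>b = d\<close>, 1 to the edges of
    \<open>E\<close> and \<open>c / 8\<close> to \<open>X\<close>, which leaves \<open>c / 4\<close>
    for \<open>R\<close>.\<close>
  have "W \<le> (\<Sum>b\<in>B. \<Sum>d\<in>B. (if b = d then 1 else 0) + (if {b, d} \<in> E then 1 else 0)
        + r b * r d * real (card (X b d)) + r b * r d * real (card (R b d)))"
    unfolding W_def using split by (intro sum_mono) auto
  also have "\<dots> = (\<Sum>b\<in>B. \<Sum>d\<in>B. if b = d then 1 else (0::real))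
      + (\<Sum>b\<in>B. \<Sum>d\<in>B. if {b, d} \<in> E then 1 else (0::real))
      + (\<Sum>b\<in>B. \<Sum>d\<in>B. r b * r d * real (card (X b d)))
      + (\<Sum>b\<in>B. \<Sum>d\<in>B. r b * r d * real (card (R b d)))"
    by (simp only: sum.distrib)
  finally have wR: "c / 4 * (real l)\<^sup>2 \<le> (\<Sum>b\<in>B. \<Sum>d\<in>B. r b * r d * real (card (R b d)))"
    using W diag adj wXsum by (simp add: algebra_simps)

  \<comment> \<open>The sides lie in \<open>M\<close>, which is disjoint from \<open>E\<close>; the
    diagonal \<open>{a, c}\<close> avoids \<open>E\<close> by the choice of \<open>Q\<close>, and
    \<open>{b, d}\<close> by that of \<open>R\<close>.\<close>
  have good: "{{a, b}, {b, c}, {c, d}, {d, a}} \<in> G"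
    if "b \<in> B" "d \<in> B" "(a, c) \<in> R b d" for a b c d
  proof -
    have bd: "b \<noteq> d" "{b, d} \<notin> E" "(a, c) \<in> Q b" "(a, c) \<in> Q d" "(a, c) \<notin> X b d"
      using that(3) by (auto simp: R_def split: if_splits)
    have ac: "a \<noteq> c" "{a, c} \<notin> E" and M4: "{a, b} \<in> M" "{b, c} \<in> M" "{c, d} \<in> M" "{d, a} \<in> M"
      using bd(3,4) by (auto simp: Q_def nonadjacent_pairs_def nbhd_def insert_commute)
    have "a \<noteq> b" "b \<noteq> c" "c \<noteq> d" "d \<noteq> a" using cM M4 by fastforce+
    moreover have sub: "{a, b, c, d} \<subseteq> {..<n}"
      using that(1,2) B(1) bd(3) QN(1)[of b] Nsub[of b] by auto
    ultimately have C4: "{{a, b}, {b, c}, {c, d}, {d, a}} \<in> C4_copies {..<n}"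
      unfolding C4_copies_def using ac(1) bd(1) by (intro CollectI exI conjI refl) auto
    have noE: "\<not> e \<subseteq> {a, b, c, d}" if e: "e \<in> E" for e
    proof
      assume sub: "e \<subseteq> {a, b, c, d}"
      obtain x y where xy: "e = {x, y}" "x \<noteq> y" using cE[OF e] by (auto simp: card_2_iff)
      have "{a, b} \<notin> E" "{b, c} \<notin> E" "{c, d} \<notin> E" "{d, a} \<notin> E" using M4 disj by blast+
      then show False using sub e ac bd(2) xy by (auto simp: insert_commute)
    qed
    have no\<C>: "\<not> p \<subseteq> {{a, b}, {b, c}, {c, d}, {d, a}}" if p: "p \<in> \<C>" for p
    proof
      assume sub: "p \<subseteq> {{a, b}, {b, c}, {c, d}, {d, a}}"
      obtain e f where ef: "p = {e, f}" "e \<noteq> f" using \<C>(1)[OF p] by (auto simp: card_2_iff)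
      have D: "(a, c) \<notin> D b" "(a, c) \<notin> D d" using bd by (auto simp: Q_def)
      have "{{a, b}, {b, c}} \<notin> \<C>" "{{a, d}, {d, c}} \<notin> \<C>"
        using D bd(3,4) unfolding D_def Q_def by blast+
      then have np: "p \<noteq> {{a, b}, {b, c}}" "p \<noteq> {{c, d}, {d, a}}"
        using p by (auto simp: insert_commute)
      have "\<not> (b \<in> \<Union>p \<and> d \<in> \<Union>p \<and> (a \<in> \<Union>p \<or> c \<in> \<Union>p))"
        using bd(3,4,5) p unfolding X_def by blast
      then have nq: "p \<noteq> q" if "b \<in> \<Union>q \<and> d \<in> \<Union>q \<and> (a \<in> \<Union>q \<or> c \<in> \<Union>q)" for q
        using that by metis
      have "p \<noteq> {{a, b}, {c, d}}" "p \<noteq> {{a, b}, {d, a}}" "p \<noteq> {{b, c}, {c, d}}"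
        "p \<noteq> {{b, c}, {d, a}}" by (rule nq, simp)+
      moreover have "p \<in> {{{a, b}, {b, c}}, {{a, b}, {c, d}}, {{a, b}, {d, a}},
          {{b, c}, {c, d}}, {{b, c}, {d, a}}, {{c, d}, {d, a}}}"
        using two_elements_of_four[OF ef(2)] sub unfolding ef(1) .
      ultimately show False using np unfolding insert_iff empty_iff by metis
    qed
    have "\<Union>{{a, b}, {b, c}, {c, d}, {d, a}} = {a, b, c, d}" by auto
    then show ?thesis
      unfolding G_def good_C4_copies_def using C4 M4 noE no\<C> by auto
  qed

  have finG: "finite G"
    by (rule finite_subset[of _ "Pow M"]) (auto simp: G_def good_C4_copies_def finM)
  define T where "T = (SIGMA q:B \<times> B. R (fst q) (snd q))"
  have UG: "finite (\<Union>K)" "card (\<Union>K) \<le> 4" if KG: "K \<in> G" for K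
  proof -
    have "K \<in> C4_copies {..<n}" using KG by (simp add: G_def good_C4_copies_def)
    then obtain a b c d where "K = {{a, b}, {b, c}, {c, d}, {d, a}}"
      unfolding C4_copies_def by (elim CollectE exE conjE)
    then have K: "\<Union>K = set [a, b, c, d]" by auto
    show "finite (\<Union>K)" unfolding K by simp
    show "card (\<Union>K) \<le> 4" unfolding K using card_length[of "[a, b, c, d]"] by simp
  qed
  \<comment> \<open>A quadruple consists of vertices of its cycle, so each cycle arises from at most
    \<open>4 ^ 4 = 256\<close> quadruples.\<close>
  have "T \<subseteq> (\<Union>K\<in>G. (\<Union>K \<times> \<Union>K) \<times> (\<Union>K \<times> \<Union>K))"
  proof
    fix q assume "q \<in> T"
    then obtain a b c d where q: "q = ((b, d), (a, c))" "b \<in> B" "d \<in> B" "(a, c) \<in> R b d"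
      unfolding T_def by (elim SigmaE) (metis fst_conv snd_conv surj_pair)
    have "\<Union>{{a, b}, {b, c}, {c, d}, {d, a}} = {a, b, c, d}" by auto
    then show "q \<in> (\<Union>K\<in>G. (\<Union>K \<times> \<Union>K) \<times> (\<Union>K \<times> \<Union>K))"
      by (intro UN_I[OF good[OF q(2,3,4)]]) (simp only: q(1), simp)
  qed
  then have "card T \<le> card (\<Union>K\<in>G. (\<Union>K \<times> \<Union>K) \<times> (\<Union>K \<times> \<Union>K))"
    using finG UG(1) by (intro card_mono) auto
  also have "\<dots> \<le> 256 * card G"
  proof (rule card_UN_le_mult[OF finG])
    fix K assume "K \<in> G"
    then have "card (\<Union>K) * card (\<Union>K) * (card (\<Union>K) * card (\<Union>K)) \<le> 4 * 4 * (4 * 4)"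
      using UG(2) by (intro mult_le_mono) auto
    then show "card ((\<Union>K \<times> \<Union>K) \<times> (\<Union>K \<times> \<Union>K)) \<le> 256" by (simp add: card_cartesian_product)
  qed
  finally have cT: "real (card T) \<le> 256 * real (card G)" by linarith
  have finR: "finite (R b d)" for b d using finQ by (simp add: R_def)
  have "(\<Sum>b\<in>B. \<Sum>d\<in>B. r b * r d * real (card (R b d)))
      \<le> (\<Sum>b\<in>B. \<Sum>d\<in>B. (1 / (\<kappa> * real l))\<^sup>2 * real (card (R b d)))"
    unfolding power2_eq_square using rle r0 kl
    by (intro sum_mono mult_right_mono mult_mono) auto
  also have "\<dots> = (1 / (\<kappa> * real l))\<^sup>2 * (\<Sum>b\<in>B. \<Sum>d\<in>B. real (card (R b d)))"
    by (simp add: sum_distrib_left)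
  also have "(\<Sum>b\<in>B. \<Sum>d\<in>B. real (card (R b d))) = real (card T)"
    unfolding T_def sum.cartesian_product case_prod_beta using finB finR by simp
  also have "(1 / (\<kappa> * real l))\<^sup>2 * real (card T) = real (card T) / (\<kappa> * real l)\<^sup>2"
    by (simp add: power_divide)
  finally have "c / 4 * (real l)\<^sup>2 \<le> real (card T) / (\<kappa> * real l)\<^sup>2"
    using wR by linarith
  then have "c / 4 * (real l)\<^sup>2 * (\<kappa> * real l)\<^sup>2 \<le> real (card T)"
    by (subst (asm) pos_le_divide_eq) (use \<kappa> l(1) in simp_all)
  then have "c * \<kappa>\<^sup>2 / 4 * real l ^ 4 \<le> 256 * real (card G)"
    using cT by (simp add: power_mult_distrib power2_eq_square power4_eq_xxxx mult_ac)
  then show ?thesis unfolding G_def by simp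
qed

section \<open>Lower bound for the total path weight\<close>

lemma weighted_nonadjacent_pairs_ge:
  fixes \<kappa> s :: real
  assumes "finite V" and "M \<subseteq> complete_edges V" and "\<And>e. e \<in> E \<Longrightarrow> card e = 2"
    and "0 < \<kappa>" and "0 \<le> s" and "0 < l"
    and "\<And>b. 2 * real (card (E \<inter> complete_edges (nbhd M b))) \<le> s * real l * real (card (nbhd M b))"
  shows "2 * real (card M) - (\<kappa> * real l + 1 + s * real l) * real (card V)
      \<le> (\<Sum>b | b \<in> V \<and> \<kappa> * real l \<le> real (card (nbhd M b)).
          real (card (nonadjacent_pairs E (nbhd M b))) / real (card (nbhd M b)))"
proof -
  define d where "d b = real (card (nbhd M b))" for b
  define w where "w b = real (card (nonadjacent_pairs E (nbhd M b))) / d b" for b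
  have finN: "finite (nbhd M b)" for b
    by (rule finite_subset[OF _ assms(1)]) (use assms(2) in \<open>auto simp: nbhd_def complete_edges_def\<close>)
  have kl: "0 < \<kappa> * real l" "0 \<le> s * real l" using assms by auto
  \<comment> \<open>A vertex of large degree has weight at least \<open>d b - 1 - s * l\<close>. For
    a vertex of small degree the left side is negative, so omitting it costs no more than the term
    \<open>\<kappa> * l\<close>.\<close>
  have "d b - (\<kappa> * real l + 1 + s * real l) \<le> (if \<kappa> * real l \<le> d b then w b else 0)" for b
  proof (cases "\<kappa> * real l \<le> d b")
    case True
    then have d: "0 < d b" using kl by linarith
    have "(d b - 1 - s * real l) * d b \<le> real (card (nonadjacent_pairs E (nbhd M b)))"
      using card_nonadjacent_pairs_ge[OF finN[of b] assms(3), of E] assms(7)[of b]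
      by (simp add: d_def algebra_simps)
    then have "d b - 1 - s * real l \<le> w b" unfolding w_def using d by (simp add: pos_le_divide_eq)
    then show ?thesis using True kl by simp
  qed (use kl in auto)
  then have "(\<Sum>b\<in>V. d b - (\<kappa> * real l + 1 + s * real l))
      \<le> (\<Sum>b\<in>V. if \<kappa> * real l \<le> d b then w b else 0)"
    by (intro sum_mono) auto
  also have "\<dots> = (\<Sum>b | b \<in> V \<and> \<kappa> * real l \<le> d b. w b)"
    using assms(1) by (simp add: sum.If_cases Int_def)
  finally have "(\<Sum>b\<in>V. d b) - (\<kappa> * real l + 1 + s * real l) * real (card V)
      \<le> (\<Sum>b | b \<in> V \<and> \<kappa> * real l \<le> d b. w b)"
    by (simp add: sum_subtractf mult.commute)
  moreover have "(\<Sum>b\<in>V. d b) = 2 * real (card M)"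
    unfolding d_def using sum_card_nbhd[OF assms(1,2)]
    by (metis of_nat_mult of_nat_numeral of_nat_sum)
  ultimately show ?thesis unfolding d_def w_def by simp
qed

section \<open>Choice of the constants and the two density cases\<close>

theorem theorem3p2:
  fixes \<epsilon> :: real
  assumes "0 < \<epsilon>" and "\<epsilon> \<le> 1/2"
  shows "\<exists>\<beta> \<delta> lam C :: real. \<beta> > 0 \<and> \<delta> > 0 \<and> lam > 0 \<and> C > 0 \<and>
    (\<forall>(l::nat) (n::nat). n \<ge> 1 \<and> real l \<ge> C * sqrt (real n) \<longrightarrow>
      (\<forall>M E :: nat set set. pregraph n M E \<and> card E \<le> l choose 2 \<and>
          (card M \<ge> 3 * l * n \<or>
           (real (card M) \<ge> (1 - \<delta>) * real l * real n \<and>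
            \<not> close_to_complete n \<epsilon> l E \<and> real l \<le> lam * real n)) \<longrightarrow>
        (\<forall>\<C> :: nat set set set.
           (\<forall>p\<in>\<C>. p \<subseteq> M \<and> card p = 2) \<and> real (card \<C>) \<le> 12 * \<beta> * real l ^ 3 \<longrightarrow>
           real (card {K \<in> good_C4_copies n M E. \<forall>p\<in>\<C>. \<not> p \<subseteq> K}) \<ge> 3 * \<beta> * real l ^ 4)))"
proof -
  \<comment> \<open>Here \<open>c\<close> is the gain for sets \<open>E\<close> that are not close
    to complete, and \<open>12288 = 12 * 1024\<close> fits the two bounds of
    \<open>good_C4_count\<close>. The other witnesses are \<open>\<delta> = c / 8\<close>,
    \<open>lam = 1\<close> and \<open>C = 8 / c\<close>.\<close>
  define c where "c = \<epsilon> / 20"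
  define \<kappa> where "\<kappa> = c / 8"
  define \<beta> where "\<beta> = c * \<kappa>\<^sup>2 / 12288"
  have c: "0 < c" "c \<le> 1/40" "20 * c \<le> \<epsilon>" using assms by (auto simp: c_def)
  have \<kappa>: "0 < \<kappa>" "\<kappa> \<le> 1" using c by (auto simp: \<kappa>_def)
  have \<beta>: "0 < \<beta>" "12 * 1024 * \<beta> \<le> c * \<kappa>" "3 * \<beta> \<le> c * \<kappa>\<^sup>2 / 1024"
    using c \<kappa> by (auto simp: \<beta>_def power2_eq_square mult_le_cancel_left1)
  have main: "3 * \<beta> * real l ^ 4 \<le> real (card {K \<in> good_C4_copies n M E. \<forall>p\<in>\<C>. \<not> p \<subseteq> K})"
    if n: "1 \<le> n" and ln: "8 / c * sqrt (real n) \<le> real l" and P: "pregraph n M E"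
      and E: "card E \<le> l choose 2"
      and dense: "3 * l * n \<le> card M \<or> (1 - c / 8) * real l * real n \<le> real (card M) \<and>
        \<not> close_to_complete n \<epsilon> l E \<and> real l \<le> 1 * real n"
      and \<C>: "\<forall>p\<in>\<C>. p \<subseteq> M \<and> card p = 2" "real (card \<C>) \<le> 12 * \<beta> * real l ^ 3"
    for l n M E \<C>
  proof -
    have Msub: "M \<subseteq> complete_edges {..<n}" and Esub: "E \<subseteq> complete_edges {..<n}"
      using P by (auto simp: pregraph_def)
    have finE: "finite E" using Esub finite_complete_edges finite_subset by blast
    have cE: "card e = 2" if "e \<in> E" for e using that Esub by (auto simp: complete_edges_def)
    have Nsub: "nbhd M b \<subseteq> {..<n}" for b using Msub by (auto simp: nbhd_def complete_edges_def)
    then have finN: "finite (nbhd M b)" for b using finite_subset by blast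
    \<comment> \<open>The lower bound on \<open>l\<close> has two uses:
      \<open>1 \<le> c / 8 * l\<close> absorbs the loss of 1 per vertex, and
      \<open>n \<le> c / 8 * l\<^sup>2\<close> makes the degenerate cycles negligible.\<close>
    have "8 / c * 1 \<le> 8 / c * sqrt (real n)" using n c by (intro mult_left_mono) auto
    then have lc: "8 / c \<le> real l" using ln by linarith
    then have l: "0 < l" using c by (cases l) (auto simp: field_simps)
    have lc': "1 \<le> c / 8 * real l" using lc c by (simp add: field_simps)
    have "(8 / c * sqrt (real n))\<^sup>2 \<le> (real l)\<^sup>2" using ln c by (intro power_mono) auto
    then have "(8 / c)\<^sup>2 * real n \<le> (real l)\<^sup>2" by (simp only: power_mult_distrib) simp
    moreover have "8 / c * real n \<le> (8 / c)\<^sup>2 * real n"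
      using c by (intro mult_right_mono) (auto simp: power2_eq_square field_simps)
    ultimately have "8 / c * real n \<le> (real l)\<^sup>2" by linarith
    then have nl: "real n \<le> c / 8 * (real l)\<^sup>2" using c by (simp add: field_simps)
    \<comment> \<open>With \<open>3 * l * n\<close> mixed edges this follows from
      \<open>card M \<le> n choose 2\<close>; in the other case it is the assumption with
      \<open>lam = 1\<close>.\<close>
    have lln: "l \<le> n"
      using dense
    proof
      assume "3 * l * n \<le> card M"
      also have "card M \<le> n choose 2"
        using card_mono[OF finite_complete_edges Msub] card_complete_edges[of "{..<n}"] by simp
      finally have "3 * l * n \<le> n choose 2" .
      moreover have "2 * (n choose 2) \<le> n * n"
        using twice_choose_two_le[of n] unfolding power2_eq_square
        by (metis of_nat_le_iff of_nat_mult of_nat_numeral)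
      ultimately have "l * n \<le> n * n" by linarith
      then show ?thesis using n by simp
    qed auto
    define B where "B = {b. b \<in> {..<n} \<and> \<kappa> * real l \<le> real (card (nbhd M b))}"
    have lower: "2 * real (card M) - (\<kappa> * real l + 1 + s * real l) * real n
        \<le> (\<Sum>b\<in>B. real (card (nonadjacent_pairs E (nbhd M b))) / real (card (nbhd M b)))"
      if "0 \<le> s" "\<And>b. 2 * real (card (E \<inter> complete_edges (nbhd M b)))
          \<le> s * real l * real (card (nbhd M b))" for s
      using weighted_nonadjacent_pairs_ge[OF finite_lessThan Msub cE \<kappa>(1) that(1) l that(2)]
      by (simp add: B_def)
    have key: "(1 + c / 2) * real l * real n
        \<le> (\<Sum>b\<in>B. real (card (nonadjacent_pairs E (nbhd M b))) / real (card (nbhd M b)))"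
      using dense
    proof
      assume "3 * l * n \<le> card M"
      then have "real (3 * l * n) \<le> real (card M)" by (simp only: of_nat_le_iff)
      moreover have "(\<kappa> * real l + 1 + 1 * real l) * real n \<le> (3 * real l) * real n"
      proof (rule mult_right_mono)
        have "\<kappa> * real l \<le> 1 * real l" using \<kappa> by (intro mult_right_mono) auto
        then show "\<kappa> * real l + 1 + 1 * real l \<le> 3 * real l" using l by linarith
      qed simp
      moreover have "(1 + c / 2) * real l * real n \<le> 2 * real l * real n"
        using c by (intro mult_right_mono) auto
      ultimately show ?thesis
        using lower[of 1] card_edges_within_le_mult[OF finE E finN] by simp
    next
      assume d: "(1 - c / 8) * real l * real n \<le> real (card M) \<and>
        \<not> close_to_complete n \<epsilon> l E \<and> real l \<le> 1 * real n"
      have "2 * real (card M) - (\<kappa> * real l + 1 + (1 - c) * real l) * real n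
        \<le> (\<Sum>b\<in>B. real (card (nonadjacent_pairs E (nbhd M b))) / real (card (nbhd M b)))"
        using c d by (intro lower card_edges_within_le_mult_if_not_close[OF _ finE E Nsub lln _ _ assms(2)]) auto
      moreover have "(\<kappa> * real l + 1 + (1 - c) * real l) * real n
          \<le> (\<kappa> * real l + c / 8 * real l + (1 - c) * real l) * real n"
        using lc' by (intro mult_right_mono) auto
      \<comment> \<open>Of the gain \<open>c\<close>, the deficit in \<open>card M\<close> uses
        \<open>c / 4\<close>, and the small degrees and the loss of 1 per vertex use
        \<open>c / 8\<close> each; \<open>c / 2\<close> remains.\<close>
      moreover have "2 * ((1 - c / 8) * real l * real n)
          - (\<kappa> * real l + c / 8 * real l + (1 - c) * real l) * real n
          = (1 + c / 2) * real l * real n"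
        by (simp add: \<kappa>_def algebra_simps)
      ultimately show ?thesis using d by linarith
    qed
    have E2: "2 * real (card E) \<le> (real l)\<^sup>2"
      using E twice_choose_two_le[of l] by linarith
    have "1024 * real (card \<C>) \<le> 12 * 1024 * \<beta> * real l ^ 3" using \<C>(2) by simp
    also have "\<dots> \<le> c * \<kappa> * real l ^ 3" using \<beta>(2) by (intro mult_right_mono) auto
    finally have C2: "1024 * real (card \<C>) \<le> c * \<kappa> * real l ^ 3" .
    have "c * \<kappa>\<^sup>2 / 1024 * real l ^ 4
        \<le> real (card {K \<in> good_C4_copies n M E. \<forall>p\<in>\<C>. \<not> p \<subseteq> K})"
      by (rule good_C4_count[OF P l lln c(1) _ \<kappa>(1) _ _ E2 nl _ C2 key])
        (use c \<C>(1) in \<open>auto simp: B_def\<close>)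
    moreover have "3 * \<beta> * real l ^ 4 \<le> c * \<kappa>\<^sup>2 / 1024 * real l ^ 4"
      using \<beta>(3) by (intro mult_right_mono) auto
    ultimately show ?thesis by linarith
  qed
  show ?thesis
  proof (intro exI conjI allI impI)
    show "0 < \<beta>" "0 < c / 8" "0 < (1::real)" "0 < 8 / c" using \<beta> c by auto
  qed (use main in blast)
qed

end
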